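(* Let $n$ be a positive multiple of $4$, and let $A_1,\dots,A_n\in\{0,1\}$ be fixed, with $\sum_{i=1}^nA_i=n/2$. Let $Y_1,\dots,Y_n$ be exchangeable random variables with values in a standard Borel space $\mathcal{Y}$, and let $T:\mathcal{Y}^n\to\mathbb{R}$ be a (measurable) test statistic (which may depend on the fixed values $A_1,\dots,A_n$). For a finite integer $m\ge1$ let \[p_m=\frac{1+\sum_{i=1}^m\mathbf{1}\{T(Y_{\sigma_i(1)},\dots,Y_{\sigma_i(n)})\ge T(Y_1,\dots,Y_n)\}}{m+1},\] where $\sigma_1,\dots,\sigma_m$ are i.i.d. uniform on $\mathcal{S}_{n,\mathrm{bal}}$ (independent of the data), and for $m=\infty$ let \[p_\infty=\frac{\sum_{\sigma\in\mathcal{S}_{n,\mathrm{bal}}}\mathbf{1}\{T(Y_{\sigma(1)},\dots,Y_{\sigma(n)})\ge T(Y_1,\dots,Y_n)\}}{|\mathcal{S}_{n,\mathrm{bal}}|}.\] Then, for every finite $m\ge1$ and for $m=\infty$, \[\mathbb{P}\{p_m\le\alpha\}\le2\alpha\left(1-\frac{1}{\mathrm{Bal}_n}\right)+\frac{2}{\mathrm{Bal}_n}\quad\text{for all }\alpha\in[0,1],\] where \[\mathrm{Bal}_n=\max\left\{k:\exists\,\sigma_1,\dots,\sigma_k\in\mathcal{S}_n,\ \sigma_i\circ\sigma_j^{-1}\in\mathcal{S}_{n,\mathrm{bal}}\ \forall\, i\ne j\in[k]\right\}.\]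
   Context: $\mathcal{S}_n$ is the group of permutations of $[n]=\{1,\dots,n\}$. The set of balanced permutations (relative to the fixed vector $A_1,\dots,A_n$) is \[\mathcal{S}_{n,\mathrm{bal}}=\left\{\sigma\in\mathcal{S}_n:\sum_{i=1}^n\mathbf{1}\{A_i=a,A_{\sigma(i)}=b\}=n/4\ \text{for each }a,b\in\{0,1\}\right\}.\] *)

theory Defs
  imports "HOL-Probability.Probability" "HOL-Combinatorics.Permutations"
begin

(* Permutations of [n] are functions on nat that fix everything outside {1..n} (permutes),
   so composition and inverse are the plain operations on functions. *)
definition balanced_perms :: "nat \<Rightarrow> (nat \<Rightarrow> nat) \<Rightarrow> (nat \<Rightarrow> nat) set" where
  "balanced_perms n A = {\<sigma>. \<sigma> permutes {1..n} \<and>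
     (\<forall>a\<in>{0,1}. \<forall>b\<in>{0,1}.
        (\<Sum>i=1..n. of_bool (A i = a \<and> A (\<sigma> i) = b)) = real n / 4)}"

definition bal_sizes :: "nat \<Rightarrow> (nat \<Rightarrow> nat) \<Rightarrow> nat set" where
  "bal_sizes n A = {k. \<exists>\<sigma> :: nat \<Rightarrow> nat \<Rightarrow> nat.
      (\<forall>i\<in>{1..k}. \<sigma> i permutes {1..n}) \<and>
      (\<forall>i\<in>{1..k}. \<forall>j\<in>{1..k}. i \<noteq> j \<longrightarrow> \<sigma> i \<circ> inv (\<sigma> j) \<in> balanced_perms n A)}"

definition Bal :: "nat \<Rightarrow> (nat \<Rightarrow> nat) \<Rightarrow> nat" where
  "Bal n A = Max (bal_sizes n A)"

(* The maximum is taken over a finite set containing 1: the identity is not balanced, so the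
   permutations witnessing a given k are pairwise distinct. *)
lemma finite_bal_sizes:
  assumes "0 < n"
  shows "finite (bal_sizes n A)"
proof -
  have id: "id \<notin> balanced_perms n A"
  proof
    assume "id \<in> balanced_perms n A"
    then have "(\<Sum>i=1..n. of_bool (A i = 0 \<and> A (id i) = 1)) = real n / 4"
      unfolding balanced_perms_def by blast
    moreover have "(\<Sum>i=1..n. of_bool (A i = 0 \<and> A (id i) = 1)) = (0::real)"
      by (rule sum.neutral) auto
    ultimately show False using assms by simp
  qed
  have "k \<le> fact n" if k: "k \<in> bal_sizes n A" for k
  proof -
    obtain \<sigma> :: "nat \<Rightarrow> nat \<Rightarrow> nat" where
      p: "\<forall>i\<in>{1..k}. \<sigma> i permutes {1..n}" and
      b: "\<forall>i\<in>{1..k}. \<forall>j\<in>{1..k}. i \<noteq> j \<longrightarrow> \<sigma> i \<circ> inv (\<sigma> j) \<in> balanced_perms n A"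
      using k unfolding bal_sizes_def by blast
    have "inj_on \<sigma> {1..k}"
    proof (rule inj_onI, rule ccontr)
      fix i j assume ij: "i \<in> {1..k}" "j \<in> {1..k}" "\<sigma> i = \<sigma> j" "i \<noteq> j"
      then have "\<sigma> i \<circ> inv (\<sigma> j) = id"
        using p permutes_inv_o(1) by metis
      with b ij id show False by metis
    qed
    moreover have "\<sigma> ` {1..k} \<subseteq> {\<sigma>. \<sigma> permutes {1..n}}" using p by auto
    ultimately have "card {1..k} \<le> card {\<sigma>. \<sigma> permutes {1..n}}"
      by (intro card_inj_on_le) (auto simp: finite_permutations)
    then show ?thesis by (simp add: card_permutations)
  qed
  then show ?thesis by (meson finite_nat_set_iff_bounded_le)
qed

lemma one_in_bal_sizes: "1 \<in> bal_sizes n A"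
  unfolding bal_sizes_def by (auto intro!: exI[of _ "\<lambda>_. id"] permutes_id)

definition standard_borel_space :: "'y measure \<Rightarrow> bool" where
  "standard_borel_space N \<longleftrightarrow>
     (\<exists>X. completely_metrizable_space X \<and> second_countable X \<and>
          space N = topspace X \<and> sets N = sigma_sets (topspace X) {U. openin X U})"

(* (y_{\<sigma>(1)}, ..., y_{\<sigma>(n)}) as a point of the n-fold product space *)
definition permuted :: "nat \<Rightarrow> (nat \<Rightarrow> 'y) \<Rightarrow> (nat \<Rightarrow> nat) \<Rightarrow> (nat \<Rightarrow> 'y)" where
  "permuted n y \<sigma> = (\<lambda>i\<in>{1..n}. y (\<sigma> i))"

abbreviation data_space :: "nat \<Rightarrow> 'y measure \<Rightarrow> (nat \<Rightarrow> 'y) measure" where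
  "data_space n N \<equiv> Pi\<^sub>M {1..n} (\<lambda>_. N)"

context prob_space
begin

definition exchangeable :: "nat \<Rightarrow> 'y measure \<Rightarrow> (nat \<Rightarrow> 'a \<Rightarrow> 'y) \<Rightarrow> bool" where
  "exchangeable n N Y \<longleftrightarrow>
     (\<forall>i\<in>{1..n}. random_variable N (Y i)) \<and>
     (\<forall>\<sigma>. \<sigma> permutes {1..n} \<longrightarrow>
        distr M (data_space n N) (\<lambda>\<omega>. permuted n (\<lambda>i. Y i \<omega>) \<sigma>) =
        distr M (data_space n N) (\<lambda>\<omega>. permuted n (\<lambda>i. Y i \<omega>) id))"

definition iid_uniform :: "nat \<Rightarrow> 'c set \<Rightarrow> (nat \<Rightarrow> 'a \<Rightarrow> 'c) \<Rightarrow> bool" where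
  "iid_uniform m S X \<longleftrightarrow>
     indep_vars (\<lambda>_. count_space S) X {1..m} \<and>
     (\<forall>j\<in>{1..m}. distr M (count_space S) (X j) = uniform_count_measure S)"

(* The library's indep_var requires both variables to have the same type. *)
definition indep_rv ::
    "'b measure \<Rightarrow> ('a \<Rightarrow> 'b) \<Rightarrow> 'c measure \<Rightarrow> ('a \<Rightarrow> 'c) \<Rightarrow> bool" where
  "indep_rv K U L V \<longleftrightarrow>
     random_variable K U \<and> random_variable L V \<and>
     indep_set {U -` B \<inter> space M | B. B \<in> sets K} {V -` B \<inter> space M | B. B \<in> sets L}"

end

definition p_value ::
    "nat \<Rightarrow> ((nat \<Rightarrow> 'y) \<Rightarrow> real) \<Rightarrow> nat \<Rightarrow> (nat \<Rightarrow> nat \<Rightarrow> nat) \<Rightarrow> (nat \<Rightarrow> 'y) \<Rightarrow> real" where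
  "p_value n T m \<sigma> y =
     (1 + (\<Sum>j=1..m. of_bool (T (permuted n y (\<sigma> j)) \<ge> T (permuted n y id)))) / (real m + 1)"

definition p_value_inf ::
    "nat \<Rightarrow> (nat \<Rightarrow> nat) \<Rightarrow> ((nat \<Rightarrow> 'y) \<Rightarrow> real) \<Rightarrow> (nat \<Rightarrow> 'y) \<Rightarrow> real" where
  "p_value_inf n A T y =
     (\<Sum>\<sigma>\<in>balanced_perms n A. of_bool (T (permuted n y \<sigma>) \<ge> T (permuted n y id))) /
     real (card (balanced_perms n A))"

end

theory Submission
  imports Defs
begin

text \<open>
  The balanced permutations form a single double coset \<open>G s G\<close> of the stabiliser \<open>G\<close> of \<open>A\<close>,
  closed under inverses. By exchangeability the data may be permuted by a uniform \<open>\<pi>\<close>, so for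
  \<open>m = \<infinity>\<close> one bounds the proportion of the set \<open>B\<close> of those \<open>\<pi>\<close> that are beaten by at most a
  fraction \<open>x\<close> of their neighbours \<open>\<pi> \<circ> s\<close> in the Cayley graph of the balanced permutations.
  Charging each edge inside \<open>B\<close> to the endpoint with the smaller statistic shows that \<open>B\<close> spans
  few edges. A clique of size \<open>k = Bal n A\<close>, moved at random so that each of its edges is uniform,
  then meets \<open>B\<close> in a number of points whose second moment is small, and Cauchy-Schwarz gives
  \<open>|B| / n! \<le> 2 x (1 - 1/k) + 1/k\<close>.

  For finite \<open>m\<close>, the sampled permutations turn the event into a mixture over random levels \<open>x\<close> of
  the previous ones, and a rank argument for \<open>m + 1\<close> exchangeable indices bounds the mean level by
  \<open>\<alpha>\<close>.
\<close>

section \<open>Sums over permutations and over a double coset\<close>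

lemma permutes_comp_right_bij:
  assumes "p permutes I"
  shows "bij_betw (\<lambda>q. q \<circ> p) {q. q permutes I} {q. q permutes I}"
  by (rule bij_betw_byWitness[where f' = "\<lambda>q. q \<circ> inv p"])
    (use assms in \<open>auto simp: permutes_compose permutes_inv comp_assoc permutes_inv_o\<close>)

lemma sum_permutes_comp_right:
  assumes "p permutes I"
  shows "(\<Sum>q | q permutes I. f (q \<circ> p)) = (\<Sum>q | q permutes I. f q)"
  using sum.reindex_bij_betw[OF permutes_comp_right_bij[OF assms], of f] by simp

text \<open>In the application \<open>G\<close> is the stabiliser of \<open>A\<close> and
  \<open>S\<close> the set of balanced permutations. By \<open>S_GG\<close> and
  \<open>S_transitive\<close>, \<open>S\<close> is empty or a single double coset of
  \<open>G\<close>, so multiplying any of its elements on both sides by independent uniform elements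
  of \<open>G\<close> gives a uniform element of \<open>S\<close>. By \<open>S_inv\<close> the
  Cayley graph with edges from \<open>p\<close> to \<open>p \<circ> s\<close> is undirected.\<close>

locale self_inverse_double_coset =
  fixes I :: "'a set" and G S :: "('a \<Rightarrow> 'a) set"
  assumes finite_I: "finite I"
    and G_permutes: "h \<in> G \<Longrightarrow> h permutes I"
    and G_id: "id \<in> G"
    and G_comp: "h \<in> G \<Longrightarrow> h' \<in> G \<Longrightarrow> h \<circ> h' \<in> G"
    and G_inv: "h \<in> G \<Longrightarrow> inv h \<in> G"
    and S_permutes: "s \<in> S \<Longrightarrow> s permutes I"
    and S_inv: "s \<in> S \<Longrightarrow> inv s \<in> S"
    and S_GG: "h \<in> G \<Longrightarrow> s \<in> S \<Longrightarrow> h' \<in> G \<Longrightarrow> h \<circ> s \<circ> h' \<in> S"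
    and S_transitive: "s \<in> S \<Longrightarrow> s' \<in> S \<Longrightarrow> \<exists>h\<in>G. \<exists>h'\<in>G. s' = h \<circ> s \<circ> h'"
begin

abbreviation "P \<equiv> {p. p permutes I}"

lemma finite_P: "finite P"
  using finite_I by (rule finite_permutations)

lemma finite_G: "finite G"
  by (rule finite_subset[OF _ finite_P]) (use G_permutes in auto)

lemma finite_S: "finite S"
  by (rule finite_subset[OF _ finite_P]) (use S_permutes in auto)

lemma card_G_pos: "card G > 0"
  using finite_G G_id card_gt_0_iff by blast

lemma sum_G_comp_right:
  assumes "a \<in> G"
  shows "(\<Sum>h\<in>G. f (h \<circ> a)) = (\<Sum>h\<in>G. f h)"
  by (rule sum.reindex_bij_witness[where i = "\<lambda>h. h \<circ> inv a" and j = "\<lambda>h. h \<circ> a"])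
    (use assms G_permutes[OF assms] in \<open>auto simp: G_comp G_inv comp_assoc permutes_inv_o\<close>)

lemma sum_G_comp_left:
  assumes "a \<in> G"
  shows "(\<Sum>h\<in>G. f (a \<circ> h)) = (\<Sum>h\<in>G. f h)"
  by (rule sum.reindex_bij_witness[where i = "\<lambda>h. inv a \<circ> h" and j = "\<lambda>h. a \<circ> h"])
    (use assms G_permutes[OF assms] in \<open>auto simp: G_comp G_inv comp_assoc[symmetric] permutes_inv_o\<close>)

lemma sum_G_inv: "(\<Sum>h\<in>G. f (inv h)) = (\<Sum>h\<in>G. f h)"
  by (rule sum.reindex_bij_witness[where i = inv and j = inv])
    (auto simp: G_inv permutes_inv_inv[OF G_permutes])

lemma sum_S_inv: "(\<Sum>s\<in>S. f (inv s)) = (\<Sum>s\<in>S. f s)"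
  by (rule sum.reindex_bij_witness[where i = inv and j = inv])
    (auto simp: S_inv permutes_inv_inv[OF S_permutes])

lemma sum_S_translate:
  assumes a: "a \<in> G" and b: "b \<in> G"
  shows "(\<Sum>s\<in>S. f (a \<circ> s \<circ> b)) = (\<Sum>s\<in>S. f s)"
proof -
  have inv: "inv a \<circ> (a \<circ> s \<circ> b) \<circ> inv b = s" "a \<circ> (inv a \<circ> s \<circ> inv b) \<circ> b = s" for s
    using permutes_inv_o[OF G_permutes[OF a]] permutes_inv_o[OF G_permutes[OF b]]
    by (metis comp_assoc comp_id id_comp)+
  show ?thesis
    by (rule sum.reindex_bij_witness[where i = "\<lambda>s. inv a \<circ> s \<circ> inv b" and j = "\<lambda>s. a \<circ> s \<circ> b"])
      (use a b in \<open>auto simp: inv S_GG G_inv\<close>)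
qed

text \<open>The double sum over \<open>G\<close> is the same for all elements of \<open>S\<close>:
  if \<open>s' = a \<circ> s \<circ> b\<close>, the factors \<open>a\<close> and \<open>b\<close>
  are absorbed into the sums. Its total over \<open>S\<close> is then evaluated by the two-sided
  invariance of \<open>S\<close>.\<close>

lemma sum_double_coset:
  fixes f :: "('a \<Rightarrow> 'a) \<Rightarrow> real"
  assumes s: "s \<in> S"
  shows "card S * (\<Sum>h\<in>G. \<Sum>h'\<in>G. f (h \<circ> s \<circ> h')) = (card G)\<^sup>2 * (\<Sum>s'\<in>S. f s')"
proof -
  define F where "F s = (\<Sum>h\<in>G. \<Sum>h'\<in>G. f (h \<circ> s \<circ> h'))" for s
  have const: "F s' = F s" if s': "s' \<in> S" for s'
  proof -
    obtain a b where ab: "a \<in> G" "b \<in> G" "s' = a \<circ> s \<circ> b"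
      using S_transitive[OF s s'] by blast
    have "F s' = (\<Sum>h\<in>G. \<Sum>h'\<in>G. f ((h \<circ> a) \<circ> s \<circ> (b \<circ> h')))"
      unfolding F_def ab by (simp add: comp_assoc)
    also have "\<dots> = (\<Sum>h\<in>G. \<Sum>h'\<in>G. f ((h \<circ> a) \<circ> s \<circ> h'))"
      by (intro sum.cong refl sum_G_comp_left[OF ab(2), of "\<lambda>h'. f (_ \<circ> h')"])
    also have "\<dots> = F s"
      unfolding F_def by (rule sum_G_comp_right[OF ab(1), of "\<lambda>h. \<Sum>h'\<in>G. f (h \<circ> s \<circ> h')"])
    finally show ?thesis .
  qed
  have "card S * F s = (\<Sum>s'\<in>S. F s')"
    using const by simp
  also have "\<dots> = (\<Sum>h\<in>G. \<Sum>h'\<in>G. \<Sum>s'\<in>S. f (h \<circ> s' \<circ> h'))"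
    unfolding F_def by (subst sum.swap, intro sum.cong refl sum.swap)
  also have "\<dots> = (\<Sum>h\<in>G. \<Sum>h'\<in>G. \<Sum>s'\<in>S. f s')"
    by (intro sum.cong refl sum_S_translate)
  also have "\<dots> = (card G)\<^sup>2 * (\<Sum>s'\<in>S. f s')"
    by (simp add: power2_eq_square)
  finally show ?thesis unfolding F_def .
qed

section \<open>Vertex sets that span few edges of the Cayley graph\<close>

text \<open>As the order is total, each ordered edge inside \<open>B\<close> is counted by
  \<open>e\<close> in at least one of its two directions. From a given \<open>p\<close> in
  \<open>B\<close> at most \<open>x\<close> edges lead to values that are at least as large, and
  reversing all edges preserves the sum because \<open>S\<close> is closed under inverses. The two
  directions give the factor 2.\<close>

lemma sum_edges_le:
  fixes t :: "('a \<Rightarrow> 'a) \<Rightarrow> real" and x :: real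
  defines "B \<equiv> {p. p permutes I \<and> card {s\<in>S. t (p \<circ> s) \<ge> t p} \<le> x}"
  shows "(\<Sum>p\<in>P. \<Sum>s\<in>S. of_bool (p \<in> B) * of_bool (p \<circ> s \<in> B)) \<le> 2 * x * card B"
proof -
  define e :: "('a \<Rightarrow> 'a) \<Rightarrow> ('a \<Rightarrow> 'a) \<Rightarrow> real"
    where "e p q = of_bool (p \<in> B) * of_bool (q \<in> B) * of_bool (t q \<ge> t p)" for p q
  have finB: "finite B"
    unfolding B_def by (rule finite_subset[OF _ finite_P]) auto
  have BP: "P \<inter> B = B" unfolding B_def by auto
  have "(\<Sum>p\<in>P. \<Sum>s\<in>S. e p (p \<circ> s)) \<le> (\<Sum>p\<in>P. of_bool (p \<in> B) * x)"
  proof (rule sum_mono)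
    fix p assume "p \<in> P"
    have "(\<Sum>s\<in>S. e p (p \<circ> s)) \<le> (\<Sum>s\<in>S. of_bool (p \<in> B) * of_bool (t (p \<circ> s) \<ge> t p))"
      unfolding e_def by (intro sum_mono) auto
    also have "\<dots> = of_bool (p \<in> B) * card {s\<in>S. t (p \<circ> s) \<ge> t p}"
      using finite_S by (simp add: sum_distrib_left[symmetric] Int_def)
    also have "\<dots> \<le> of_bool (p \<in> B) * x"
      unfolding B_def by auto
    finally show "(\<Sum>s\<in>S. e p (p \<circ> s)) \<le> of_bool (p \<in> B) * x" .
  qed
  also have "\<dots> = x * card B"
    using finite_P BP by (simp add: sum_distrib_right[symmetric])
  finally have fwd: "(\<Sum>p\<in>P. \<Sum>s\<in>S. e p (p \<circ> s)) \<le> x * card B" .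
  have "(\<Sum>p\<in>P. \<Sum>s\<in>S. e (p \<circ> s) p) = (\<Sum>s\<in>S. \<Sum>p\<in>P. e (p \<circ> s) p)"
    by (rule sum.swap)
  \<comment> \<open>The start \<open>p \<circ> s\<close> of the reversed edge is renamed to
    \<open>p\<close>; its end is then reached through \<open>inv s\<close>.\<close>
  also have "\<dots> = (\<Sum>s\<in>S. \<Sum>p\<in>P. e p (p \<circ> inv s))"
  proof (rule sum.cong[OF refl])
    fix s assume s: "s \<in> S"
    have cancel: "p \<circ> s \<circ> inv s = p" for p
      using permutes_inv_o[OF S_permutes[OF s]] by (simp add: comp_assoc)
    have "(\<Sum>p\<in>P. e (p \<circ> s) p) = (\<Sum>p\<in>P. e (p \<circ> s) (p \<circ> s \<circ> inv s))"
      by (simp only: cancel)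
    also have "\<dots> = (\<Sum>p\<in>P. e p (p \<circ> inv s))"
      by (rule sum_permutes_comp_right[OF S_permutes[OF s], of "\<lambda>q. e q (q \<circ> inv s)"])
    finally show "(\<Sum>p\<in>P. e (p \<circ> s) p) = (\<Sum>p\<in>P. e p (p \<circ> inv s))" .
  qed
  also have "\<dots> = (\<Sum>s\<in>S. \<Sum>p\<in>P. e p (p \<circ> s))"
    by (rule sum_S_inv)
  also have "\<dots> = (\<Sum>p\<in>P. \<Sum>s\<in>S. e p (p \<circ> s))"
    by (rule sum.swap)
  finally have bwd: "(\<Sum>p\<in>P. \<Sum>s\<in>S. e (p \<circ> s) p) = (\<Sum>p\<in>P. \<Sum>s\<in>S. e p (p \<circ> s))" .
  have "(\<Sum>p\<in>P. \<Sum>s\<in>S. of_bool (p \<in> B) * of_bool (p \<circ> s \<in> B))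
      \<le> (\<Sum>p\<in>P. \<Sum>s\<in>S. e p (p \<circ> s) + e (p \<circ> s) p)"
    unfolding e_def by (intro sum_mono) auto
  also have "\<dots> \<le> 2 * x * card B"
    using fwd bwd by (simp add: sum.distrib)
  finally show ?thesis .
qed

text \<open>The random clique has the vertices \<open>g \<circ> \<kappa> i \<circ> h\<^sub>i\<close> with independent uniform \<open>g\<close> and \<open>h\<^sub>i\<close>.
  Averaging over the \<open>h\<^sub>i\<close> makes its edges uniform; in the proof \<open>b\<close> is that average, up to the
  factor \<open>card G\<close>.\<close>

lemma few_edges_imp_small:
  fixes \<kappa> :: "nat \<Rightarrow> 'a \<Rightarrow> 'a" and k :: nat and x :: real
  assumes \<kappa>: "\<And>i. i \<in> {1..k} \<Longrightarrow> \<kappa> i permutes I"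
    and clique: "\<And>i j. i \<in> {1..k} \<Longrightarrow> j \<in> {1..k} \<Longrightarrow> i \<noteq> j \<Longrightarrow> inv (\<kappa> i) \<circ> \<kappa> j \<in> S"
    and k: "k \<ge> 2" and x: "0 \<le> x" and B: "B \<subseteq> P"
    and edges: "(\<Sum>p\<in>P. \<Sum>s\<in>S. of_bool (p \<in> B) * of_bool (p \<circ> s \<in> B)) \<le> 2 * x * card B"
  shows "card B \<le> card P * (2 * (1 - 1 / k) * (x / card S) + 1 / k)"
\<comment> \<open>The last part of the argument cancels a factor \<open>card B\<close>, which has to
  be positive.\<close>
proof (cases "B = {}")
  case True
  have "0 \<le> 2 * (1 - 1 / k) * (x / card S) + 1 / k"
    using k x by (intro add_nonneg_nonneg mult_nonneg_nonneg) auto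
  then have "0 \<le> card P * (2 * (1 - 1 / k) * (x / card S) + 1 / k)"
    by (intro mult_nonneg_nonneg) auto
  then show ?thesis using True by (simp only: card.empty of_nat_0)
next
  case False
  define b where "b p = (\<Sum>h\<in>G. of_bool (p \<circ> h \<in> B) :: real)" for p
  \<comment> \<open>\<open>X g\<close> is \<open>card G\<close> times the expected number of clique
    vertices in \<open>B\<close> for a fixed \<open>g\<close>.\<close>
  define X where "X g = (\<Sum>i=1..k. b (g \<circ> \<kappa> i))" for g
  have finB: "finite B" using B finite_P by (rule finite_subset)
  have cS: "card S > 0"
    using clique[of 1 2] k finite_S by (auto simp: card_gt_0_iff)
  have cP: "card P > 0"
    using finite_P by (auto simp: card_gt_0_iff intro: permutes_id)
  have cB: "card B > 0" using False finB by (simp add: card_gt_0_iff)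
  have PB: "P \<inter> B = B" using B by blast
  have b_le: "b p \<le> card G" and b_ge: "0 \<le> b p" for p
    unfolding b_def using sum_bounded_above[of G "\<lambda>h. of_bool (p \<circ> h \<in> B)" "1::real"] by (auto intro: sum_nonneg)
  have sum_b: "(\<Sum>p\<in>P. b p) = card G * card B"
  proof -
    have "(\<Sum>p\<in>P. b p) = (\<Sum>h\<in>G. \<Sum>p\<in>P. of_bool (p \<circ> h \<in> B))"
      unfolding b_def by (rule sum.swap)
    also have "\<dots> = (\<Sum>h\<in>G. \<Sum>p\<in>P. of_bool (p \<in> B))"
      by (intro sum.cong refl sum_permutes_comp_right G_permutes)
    also have "\<dots> = card G * card B"
      using finite_P PB by simp
    finally show ?thesis .
  qed
  have sum_X: "(\<Sum>g\<in>P. X g) = k * card G * card B"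
  proof -
    have "(\<Sum>g\<in>P. X g) = (\<Sum>i=1..k. \<Sum>g\<in>P. b (g \<circ> \<kappa> i))"
      unfolding X_def by (rule sum.swap)
    also have "\<dots> = (\<Sum>i=1..k. \<Sum>g\<in>P. b g)"
      by (intro sum.cong refl sum_permutes_comp_right \<kappa>)
    finally show ?thesis by (simp add: sum_b)
  qed
  \<comment> \<open>The crude bound of one factor by \<open>card G\<close> suffices here; the
    diagonal contributes the summand \<open>1 / k\<close> of the result.\<close>
  have diag: "(\<Sum>g\<in>P. b (g \<circ> \<kappa> i) * b (g \<circ> \<kappa> i)) \<le> (card G)\<^sup>2 * card B" if "i \<in> {1..k}" for i
  proof -
    have "(\<Sum>g\<in>P. b (g \<circ> \<kappa> i) * b (g \<circ> \<kappa> i)) = (\<Sum>g\<in>P. b g * b g)"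
      by (rule sum_permutes_comp_right[OF \<kappa>[OF that], of "\<lambda>g. b g * b g"])
    also have "\<dots> \<le> (\<Sum>g\<in>P. card G * b g)"
      by (intro sum_mono mult_right_mono b_le b_ge)
    also have "\<dots> = (card G)\<^sup>2 * card B"
      by (simp add: sum_distrib_left[symmetric] sum_b power2_eq_square)
    finally show ?thesis .
  qed
  \<comment> \<open>Renaming the vertex \<open>g \<circ> \<kappa> i \<circ> h\<close> to
    \<open>g\<close> leaves an edge with the label \<open>inv h \<circ> s \<circ> h'\<close>. Over
    all \<open>h\<close> and \<open>h'\<close> in \<open>G\<close> this label is equidistributed on
    \<open>S\<close> by \<open>sum_double_coset\<close>, so that the hypothesis \<open>edges\<close>
    applies.\<close>
  have off: "(\<Sum>g\<in>P. b (g \<circ> \<kappa> i) * b (g \<circ> \<kappa> j)) \<le> (card G)\<^sup>2 * (2 * x * card B) / card S"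
    if ij: "i \<in> {1..k}" "j \<in> {1..k}" "i \<noteq> j" for i j
  proof -
    define s where "s = inv (\<kappa> i) \<circ> \<kappa> j"
    have s: "s \<in> S" unfolding s_def by (rule clique[OF ij])
    let ?c = "\<lambda>p. of_bool (p \<in> B) :: real"
    have "(\<Sum>g\<in>P. b (g \<circ> \<kappa> i) * b (g \<circ> \<kappa> j))
        = (\<Sum>g\<in>P. \<Sum>h\<in>G. \<Sum>h'\<in>G. ?c (g \<circ> \<kappa> i \<circ> h) * ?c (g \<circ> \<kappa> j \<circ> h'))"
      unfolding b_def by (simp add: sum_product)
    also have "\<dots> = (\<Sum>h\<in>G. \<Sum>h'\<in>G. \<Sum>g\<in>P. ?c (g \<circ> \<kappa> i \<circ> h) * ?c (g \<circ> \<kappa> j \<circ> h'))"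
      by (subst sum.swap, intro sum.cong refl sum.swap)
    also have "\<dots> = (\<Sum>h\<in>G. \<Sum>h'\<in>G. \<Sum>g\<in>P. ?c g * ?c (g \<circ> (inv h \<circ> s \<circ> h')))"
    proof (rule sum.cong[OF refl], rule sum.cong[OF refl])
      fix h h' assume h: "h \<in> G" "h' \<in> G"
      note inv = permutes_inv_o[OF G_permutes[OF h(1)]] permutes_inv_o[OF \<kappa>[OF ij(1)]]
      have eq: "g \<circ> \<kappa> j \<circ> h' = g \<circ> (\<kappa> i \<circ> h) \<circ> (inv h \<circ> s \<circ> h')" for g
      proof -
        have "\<kappa> i \<circ> h \<circ> (inv h \<circ> s \<circ> h') = \<kappa> i \<circ> (h \<circ> inv h) \<circ> inv (\<kappa> i) \<circ> \<kappa> j \<circ> h'"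
          unfolding s_def by (simp add: comp_assoc)
        also have "\<dots> = \<kappa> j \<circ> h'" using inv by simp
        finally show ?thesis by (simp add: comp_assoc)
      qed
      have "\<kappa> i \<circ> h permutes I"
        by (intro permutes_compose \<kappa> ij G_permutes h)
      from sum_permutes_comp_right[OF this, of "\<lambda>g. ?c g * ?c (g \<circ> (inv h \<circ> s \<circ> h'))"]
      show "(\<Sum>g\<in>P. ?c (g \<circ> \<kappa> i \<circ> h) * ?c (g \<circ> \<kappa> j \<circ> h'))
          = (\<Sum>g\<in>P. ?c g * ?c (g \<circ> (inv h \<circ> s \<circ> h')))"
        unfolding eq by (simp add: comp_assoc)
    qed
    also have "\<dots> = (\<Sum>h\<in>G. \<Sum>h'\<in>G. \<Sum>g\<in>P. ?c g * ?c (g \<circ> (h \<circ> s \<circ> h')))"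
      by (rule sum_G_inv[of "\<lambda>h. \<Sum>h'\<in>G. \<Sum>g\<in>P. ?c g * ?c (g \<circ> (h \<circ> s \<circ> h'))"])
    also have "\<dots> = (card G)\<^sup>2 * (\<Sum>s\<in>S. \<Sum>g\<in>P. ?c g * ?c (g \<circ> s)) / card S"
      using sum_double_coset[OF s, of "\<lambda>s. \<Sum>g\<in>P. ?c g * ?c (g \<circ> s)"] cS
      by (simp add: field_simps)
    also have "(\<Sum>s\<in>S. \<Sum>g\<in>P. ?c g * ?c (g \<circ> s)) = (\<Sum>g\<in>P. \<Sum>s\<in>S. ?c g * ?c (g \<circ> s))"
      by (rule sum.swap)
    also have "(card G)\<^sup>2 * \<dots> / card S \<le> (card G)\<^sup>2 * (2 * x * card B) / card S"
      by (intro divide_right_mono mult_left_mono edges) auto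
    finally show ?thesis .
  qed
  let ?D = "(card G)\<^sup>2 * real (card B)" and ?O = "(card G)\<^sup>2 * (2 * x * card B) / card S"
  have "(\<Sum>g\<in>P. (X g)\<^sup>2) = (\<Sum>g\<in>P. \<Sum>i=1..k. \<Sum>j=1..k. b (g \<circ> \<kappa> i) * b (g \<circ> \<kappa> j))"
    unfolding X_def by (simp add: power2_eq_square sum_product)
  also have "\<dots> = (\<Sum>i=1..k. \<Sum>j=1..k. \<Sum>g\<in>P. b (g \<circ> \<kappa> i) * b (g \<circ> \<kappa> j))"
    by (subst sum.swap, intro sum.cong refl sum.swap)
  also have "\<dots> \<le> (\<Sum>i=1..k. \<Sum>j=1..k. if j = i then ?D else ?O)"
    by (intro sum_mono) (use diag off in auto)
  also have "\<dots> = k * (?D + (real k - 1) * ?O)"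
  proof -
    have "(\<Sum>j=1..k. if j = i then ?D else ?O) = ?D + (real k - 1) * ?O" if "i \<in> {1..k}" for i
    proof -
      have "(\<Sum>j=1..k. if j = i then ?D else ?O) = ?D + (\<Sum>j\<in>{1..k}-{i}. ?O)"
        using that by (subst sum.remove[of _ i]) (auto intro!: sum.cong)
      then show ?thesis using that by (simp add: of_nat_diff)
    qed
    then show ?thesis by simp
  qed
  finally have sq: "(\<Sum>g\<in>P. (X g)\<^sup>2) \<le> k * (?D + (real k - 1) * ?O)" .
  \<comment> \<open>Cauchy-Schwarz over \<open>P\<close>. Once the second moment is bounded, both
    sides share the factor \<open>k * (card G)\<^sup>2 * card B\<close>.\<close>
  have "(k * card G * card B)\<^sup>2 \<le> card P * (\<Sum>g\<in>P. (X g)\<^sup>2)"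
    using sum_squared_le_sum_of_squares[of X P] finite_P sum_X by (simp add: mult.commute)
  also have "\<dots> \<le> card P * (k * (?D + (real k - 1) * ?O))"
    by (intro mult_left_mono sq) auto
  finally have "(k * card G * card B)\<^sup>2 \<le> card P * (k * (?D + (real k - 1) * ?O))" .
  also have "\<dots> = (k * (card G)\<^sup>2 * card B) * (card P * (1 + (real k - 1) * (2 * x / card S)))"
    by (simp add: field_simps)
  finally have "(k * (card G)\<^sup>2 * card B) * (k * card B)
      \<le> (k * (card G)\<^sup>2 * card B) * (card P * (1 + (real k - 1) * (2 * x / card S)))"
    by (simp add: power2_eq_square ac_simps)
  moreover have "real (k * (card G)\<^sup>2 * card B) > 0"
    using k card_G_pos cB by simp
  ultimately have "k * card B \<le> card P * (1 + (real k - 1) * (2 * x / card S))"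
    unfolding of_nat_mult by (rule mult_left_le_imp_le)
  moreover have "real k * (card P * (2 * (1 - 1 / k) * (x / card S) + 1 / k))
      = card P * (1 + (real k - 1) * (2 * x / card S))"
  proof -
    have "real k * (card P * (2 * (1 - 1 / k) * y + 1 / k))
        = card P * (1 + (real k - 1) * (2 * y))" for y :: real
      using k by (simp add: field_simps)
    from this[of "x / card S"] show ?thesis by simp
  qed
  ultimately have "real k * card B \<le> real k * (card P * (2 * (1 - 1 / k) * (x / card S) + 1 / k))"
    by (simp only: of_nat_mult)
  then show ?thesis
    by (rule mult_left_le_imp_le) (use k in simp)
qed

end

section \<open>Ranks among \<open>m + 1\<close> indices\<close>

text \<open>Take a low-ranked index \<open>l\<close> with the largest value. Every other low-ranked
  index has a value of at most \<open>v l\<close>, so it is among the at most \<open>r\<close>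
  indices counted at \<open>l\<close>.\<close>

lemma card_low_rank_le:
  fixes v :: "'i \<Rightarrow> 'b::linorder"
  assumes "finite I"
  shows "card {l\<in>I. card {i\<in>I. v i \<le> v l} \<le> r} \<le> r"
proof (cases "{l\<in>I. card {i\<in>I. v i \<le> v l} \<le> r} = {}")
  case False
  let ?C = "{l\<in>I. card {i\<in>I. v i \<le> v l} \<le> r}"
  have fin: "finite (v ` ?C)" using assms by simp
  then have "Max (v ` ?C) \<in> v ` ?C" using False by (intro Max_in) auto
  then obtain l where l: "l \<in> ?C" "Max (v ` ?C) = v l" by blast
  have "?C \<subseteq> {i\<in>I. v i \<le> v l}"
    using Max_ge[OF fin] l(2) by auto
  then have "card ?C \<le> card {i\<in>I. v i \<le> v l}"
    using assms by (intro card_mono) auto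
  then show ?thesis using l(1) by simp
qed (metis card.empty le0)

text \<open>Transposing the indices \<open>0\<close> and \<open>l\<close> maps the set of functions
  to itself, so every index has low rank equally often. Summing over all \<open>m + 1\<close>
  indices and exchanging the sums, at most \<open>r\<close> of them have low rank for each
  function.\<close>

lemma card_first_rank_le:
  "(m + 1) * card {v \<in> {0..m} \<rightarrow>\<^sub>E {..<L::nat}. card {i\<in>{0..m}. v i \<le> v 0} \<le> r} \<le> r * L ^ (m + 1)"
proof -
  define V where "V = {0..m} \<rightarrow>\<^sub>E {..<L}"
  define R where "R l v \<longleftrightarrow> card {i\<in>{0..m}. v i \<le> v l} \<le> r" for l :: nat and v :: "nat \<Rightarrow> nat"
  have finV: "finite V" unfolding V_def by (intro finite_PiE) auto
  have cardV: "card V = L ^ (m + 1)" unfolding V_def by (subst card_PiE) auto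
  have sym: "card {v\<in>V. R l v} = card {v\<in>V. R 0 v}" if l: "l \<in> {0..m}" for l
  proof (rule bij_betw_same_card[of "\<lambda>v. v \<circ> Transposition.transpose 0 l"], rule bij_betw_byWitness[where f' = "\<lambda>v. v \<circ> Transposition.transpose 0 l"])
    have tm: "Transposition.transpose 0 l i \<in> {0..m} \<longleftrightarrow> i \<in> {0..m}" for i
      using l by (auto simp: Transposition.transpose_def)
    have V: "v \<circ> Transposition.transpose 0 l \<in> V" if "v \<in> V" for v
      using that tm unfolding V_def PiE_iff extensional_def by auto
    have card: "card {i\<in>{0..m}. v (Transposition.transpose 0 l i) \<le> x} = card {i\<in>{0..m}. v i \<le> x}"
      for v :: "nat \<Rightarrow> nat" and x
      by (rule bij_betw_same_card[of "Transposition.transpose 0 l"], rule bij_betw_byWitness[where f' = "Transposition.transpose 0 l"])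
        (use tm in auto)
    show "(\<lambda>v. v \<circ> Transposition.transpose 0 l) ` {v\<in>V. R l v} \<subseteq> {v\<in>V. R 0 v}"
      using V card by (auto simp: R_def)
    show "(\<lambda>v. v \<circ> Transposition.transpose 0 l) ` {v\<in>V. R 0 v} \<subseteq> {v\<in>V. R l v}"
      using V card by (auto simp: R_def)
  qed (auto simp: comp_assoc)
  have "(m + 1) * card {v\<in>V. R 0 v} = (\<Sum>l\<in>{0..m}. card {v\<in>V. R 0 v})"
    by simp
  also have "\<dots> = (\<Sum>l\<in>{0..m}. card {v\<in>V. R l v})"
    by (rule sum.cong[OF refl sym[symmetric]])
  also have "\<dots> = (\<Sum>v\<in>V. card {l\<in>{0..m}. R l v})"
    using sum.swap[of "\<lambda>l v. of_bool (R l v) :: nat" V "{0..m}"] finV by (simp add: Int_def)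
  also have "\<dots> \<le> (\<Sum>v\<in>V. r)"
    unfolding R_def by (intro sum_mono card_low_rank_le) auto
  also have "\<dots> = r * L ^ (m + 1)"
    by (simp add: cardV)
  finally show ?thesis unfolding V_def R_def .
qed

text \<open>Placing \<open>j\<close> at the new index \<open>0\<close> turns a pair
  \<open>(u, j)\<close> into a function on \<open>{0..m}\<close>. Index \<open>0\<close> is counted
  in its own rank, so fewer than \<open>r\<close> among \<open>{1..m}\<close> becomes at most
  \<open>r\<close> among \<open>{0..m}\<close>.\<close>

lemma sum_card_below_le:
  "(m + 1) * (\<Sum>u\<in>{1..m} \<rightarrow>\<^sub>E {..<L::nat}. card {j\<in>{..<L}. card {i\<in>{1..m}. u i \<le> j} < r})
    \<le> r * L ^ (m + 1)"
proof -
  let ?U = "{1..m} \<rightarrow>\<^sub>E {..<L}"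
  let ?W = "SIGMA u:?U. {j\<in>{..<L}. card {i\<in>{1..m}. u i \<le> j} < r}"
  let ?V = "{v \<in> {0..m} \<rightarrow>\<^sub>E {..<L}. card {i\<in>{0..m}. v i \<le> v 0} \<le> r}"
  have "card ?W \<le> card ?V"
  proof (rule card_inj_on_le[where f = "\<lambda>(u, j). u(0 := j)"])
    show "inj_on (\<lambda>(u, j). u(0 := j)) ?W"
    proof (rule inj_onI, clarify)
      fix u j u' j' assume u: "u \<in> ?U" "u' \<in> ?U" and eq: "u(0 := j) = u'(0 := j')"
      have "u i = u' i" for i
        using fun_cong[OF eq, of i] u by (cases "i = 0") (auto simp: PiE_iff extensional_def)
      then show "u = u' \<and> j = j'"
        using fun_cong[OF eq, of 0] by auto
    qed
    show "(\<lambda>(u, j). u(0 := j)) ` ?W \<subseteq> ?V"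
    proof clarify
      fix u j assume u: "u \<in> ?U" and j: "j < L" "card {i\<in>{1..m}. u i \<le> j} < r"
      have "{i\<in>{0..m}. (u(0 := j)) i \<le> (u(0 := j)) 0} = insert 0 {i\<in>{1..m}. u i \<le> j}"
        by (auto split: if_splits)
      then have "card {i\<in>{0..m}. (u(0 := j)) i \<le> (u(0 := j)) 0} \<le> r"
        using j by simp
      moreover have "u(0 := j) \<in> {0..m} \<rightarrow>\<^sub>E {..<L}"
        using u j by (auto simp: PiE_iff extensional_def)
      ultimately show "u(0 := j) \<in> {0..m} \<rightarrow>\<^sub>E {..<L}
          \<and> card {i\<in>{0..m}. (u(0 := j)) i \<le> (u(0 := j)) 0} \<le> r" by blast
    qed
    show "finite ?V" by (intro finite_subset[OF _ finite_PiE[of "{0..m}" "\<lambda>_. {..<L}"]]) auto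
  qed
  moreover have "card ?W = (\<Sum>u\<in>?U. card {j\<in>{..<L}. card {i\<in>{1..m}. u i \<le> j} < r})"
    by (rule card_SigmaI) (auto intro: finite_PiE)
  ultimately have "(m + 1) * (\<Sum>u\<in>?U. card {j\<in>{..<L}. card {i\<in>{1..m}. u i \<le> j} < r})
      \<le> (m + 1) * card ?V"
    by (intro mult_le_mono2) simp
  also have "\<dots> \<le> r * L ^ (m + 1)"
    by (rule card_first_rank_le)
  finally show ?thesis .
qed

section \<open>Sampled tuples as random levels\<close>

lemma ex_bij_betw_initial_segment:
  assumes "finite S" and "D \<subseteq> S"
  shows "\<exists>e. bij_betw e S {..<card S} \<and> (\<forall>s\<in>S. e s < card D \<longleftrightarrow> s \<in> D)"
proof -
  have le: "card D \<le> card S" using assms by (rule card_mono)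
  have finD: "finite D" using assms finite_subset by blast
  obtain f where f: "bij_betw f D {..<card D}"
    using finite_same_card_bij[OF finD, of "{..<card D}"] by auto
  have "card (S - D) = card {card D..<card S}"
    using assms finD by (simp add: card_Diff_subset)
  then obtain g where g: "bij_betw g (S - D) {card D..<card S}"
    using finite_same_card_bij[of "S - D" "{card D..<card S}"] assms by auto
  define e where "e x = (if x \<in> D then f x else g x)" for x
  have "bij_betw e (D \<union> (S - D)) ({..<card D} \<union> {card D..<card S})"
    unfolding e_def by (rule bij_betw_disjoint_Un[OF f g]) auto
  moreover have "D \<union> (S - D) = S" "{..<card D} \<union> {card D..<card S} = {..<card S}"
    using assms le by auto
  moreover have "e s < card D \<longleftrightarrow> s \<in> D" if "s \<in> S" for s
    using bij_betwE[OF f] bij_betwE[OF g] that unfolding e_def by force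
  ultimately show ?thesis by auto
qed

text \<open>Numbering \<open>S\<close> with the elements of \<open>D\<close> first replaces
  \<open>D\<close> by an initial segment of the same size. For different sets \<open>D\<close> the
  events on the right are thus nested, which makes them comparable for one common
  \<open>u\<close>.\<close>

lemma card_PiE_few_hits:
  assumes "finite S" and "D \<subseteq> S"
  shows "card {u \<in> {1..m::nat} \<rightarrow>\<^sub>E S. card {i\<in>{1..m}. u i \<in> D} < r}
    \<le> card {u \<in> {1..m} \<rightarrow>\<^sub>E {..<card S}. card {i\<in>{1..m}. u i < card D} < r}"
proof -
  obtain e where e: "bij_betw e S {..<card S}" "\<And>s. s \<in> S \<Longrightarrow> e s < card D \<longleftrightarrow> s \<in> D"
    using ex_bij_betw_initial_segment[OF assms] by blast
  show ?thesis
  proof (rule card_inj_on_le[where f = "\<lambda>u. \<lambda>i\<in>{1..m}. e (u i)"])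
    show "inj_on (\<lambda>u. \<lambda>i\<in>{1..m}. e (u i)) {u \<in> {1..m} \<rightarrow>\<^sub>E S. card {i\<in>{1..m}. u i \<in> D} < r}"
    proof (rule inj_onI)
      fix u u' assume u: "u \<in> {u \<in> {1..m} \<rightarrow>\<^sub>E S. card {i\<in>{1..m}. u i \<in> D} < r}"
        "u' \<in> {u \<in> {1..m} \<rightarrow>\<^sub>E S. card {i\<in>{1..m}. u i \<in> D} < r}"
        and eq: "(\<lambda>i\<in>{1..m}. e (u i)) = (\<lambda>i\<in>{1..m}. e (u' i))"
      have eq': "u i = u' i" if i: "i \<in> {1..m}" for i
      proof -
        have "e (u i) = e (u' i)" using fun_cong[OF eq, of i] i by simp
        then show ?thesis
          using bij_betw_imp_inj_on[OF e(1)] u i by (auto simp: inj_on_def PiE_iff)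
      qed
      show "u = u'"
      proof (rule PiE_ext[of u "{1..m}" "\<lambda>_. S" u'])
        show "u i = u' i" if "i \<in> {1..m}" for i using that by (rule eq')
      qed (use u in blast)+
    qed
    show "(\<lambda>u. \<lambda>i\<in>{1..m}. e (u i)) ` {u \<in> {1..m} \<rightarrow>\<^sub>E S. card {i\<in>{1..m}. u i \<in> D} < r}
        \<subseteq> {u \<in> {1..m} \<rightarrow>\<^sub>E {..<card S}. card {i\<in>{1..m}. u i < card D} < r}"
    proof clarify
      fix u assume u: "u \<in> {1..m} \<rightarrow>\<^sub>E S" "card {i\<in>{1..m}. u i \<in> D} < r"
      have "{i\<in>{1..m}. (\<lambda>i\<in>{1..m}. e (u i)) i < card D} = {i\<in>{1..m}. u i \<in> D}"
        using u e(2) by (auto simp: PiE_iff)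
      moreover have "(\<lambda>i\<in>{1..m}. e (u i)) \<in> {1..m} \<rightarrow>\<^sub>E {..<card S}"
        using u bij_betwE[OF e(1)] by (auto simp: PiE_iff)
      ultimately show "(\<lambda>i\<in>{1..m}. e (u i)) \<in> {1..m} \<rightarrow>\<^sub>E {..<card S}
          \<and> card {i\<in>{1..m}. (\<lambda>i\<in>{1..m}. e (u i)) i < card D} < r"
        using u(2) by simp
    qed
  qed (intro finite_subset[OF _ finite_PiE[of "{1..m}" "\<lambda>_. {..<card S}"]], auto)
qed

text \<open>With the sets \<open>D p\<close> replaced by initial segments, each fixed
  \<open>u\<close> acts as a threshold: it has few hits in \<open>D p\<close> only if
  \<open>card (D p)\<close> is at most the level \<open>J u\<close>. Thus \<open>bound\<close>
  applies for each \<open>u\<close> with \<open>x = J u\<close>. As it is affine in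
  \<open>x\<close>, only the mean of \<open>J u / L\<close> matters, and
  \<open>sum_card_below_le\<close> bounds this by \<open>r / (m + 1)\<close>.\<close>

lemma sum_few_hits_le:
  fixes D :: "'p \<Rightarrow> 's set" and c d :: real
  assumes finP: "finite P" and finS: "finite S" and S: "card S > 0"
    and D: "\<And>p. p \<in> P \<Longrightarrow> D p \<subseteq> S" and c: "0 \<le> c"
    and bound: "\<And>x::nat. card {p\<in>P. card (D p) \<le> x} \<le> card P * (c * (x / card S) + d)"
  shows "(\<Sum>p\<in>P. card {u \<in> {1..m::nat} \<rightarrow>\<^sub>E S. card {i\<in>{1..m}. u i \<in> D p} < r})
    \<le> card P * (card S ^ m * (c * (r / (m + 1)) + d))"
proof -
  define L where "L = card S"
  define U where "U = {1..m} \<rightarrow>\<^sub>E {..<L}"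
  define J where "J u = card {j\<in>{..<L}. card {i\<in>{1..m}. u i \<le> j} < r}" for u :: "nat \<Rightarrow> nat"
  have finU: "finite U" unfolding U_def by (intro finite_PiE) auto
  have cardU: "card U = L ^ m" unfolding U_def by (subst card_PiE) auto
  have L: "L > 0" using S L_def by simp
  have "(\<Sum>p\<in>P. card {u \<in> {1..m} \<rightarrow>\<^sub>E S. card {i\<in>{1..m}. u i \<in> D p} < r})
      \<le> (\<Sum>p\<in>P. card {u\<in>U. card {i\<in>{1..m}. u i < card (D p)} < r})"
    unfolding U_def L_def by (intro sum_mono card_PiE_few_hits finS D)
  also have "\<dots> = (\<Sum>u\<in>U. card {p\<in>P. card {i\<in>{1..m}. u i < card (D p)} < r})"
    using sum.swap[of "\<lambda>p u. of_bool (card {i\<in>{1..m}. u i < card (D p)} < r) :: nat" U P] finU finP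
    by (simp add: Int_def)
  also have "\<dots> \<le> (\<Sum>u\<in>U. card {p\<in>P. card (D p) \<le> J u})"
  proof (intro sum_mono card_mono subsetI)
    fix u p assume "p \<in> {p\<in>P. card {i\<in>{1..m}. u i < card (D p)} < r}"
    then have p: "p \<in> P" "card {i\<in>{1..m}. u i < card (D p)} < r" by auto
    have "card (D p) \<le> L" unfolding L_def using D[OF p(1)] finS by (intro card_mono)
    \<comment> \<open>Entries that are at most \<open>j\<close> lie below \<open>card (D p)\<close>.
      Hence all of the \<open>card (D p)\<close> smaller numbers are among those that
      \<open>J u\<close> counts.\<close>
    moreover have "card {i\<in>{1..m}. u i \<le> j} < r" if "j < card (D p)" for j
      using that by (intro le_less_trans[OF card_mono p(2)]) auto
    ultimately have "{..<card (D p)} \<subseteq> {j\<in>{..<L}. card {i\<in>{1..m}. u i \<le> j} < r}" by auto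
    from card_mono[OF _ this] show "p \<in> {p\<in>P. card (D p) \<le> J u}"
      unfolding J_def using p(1) by simp
  qed (use finP in auto)
  finally have "real (\<Sum>p\<in>P. card {u \<in> {1..m} \<rightarrow>\<^sub>E S. card {i\<in>{1..m}. u i \<in> D p} < r})
      \<le> (\<Sum>u\<in>U. real (card {p\<in>P. card (D p) \<le> J u}))"
    by (simp only: of_nat_le_iff of_nat_sum[symmetric])
  also have "\<dots> \<le> (\<Sum>u\<in>U. card P * (c * (J u / L) + d))"
    unfolding L_def by (intro sum_mono bound)
  also have "\<dots> = card P * (c * (real (\<Sum>u\<in>U. J u) / L) + L ^ m * d)"
    by (simp add: sum_distrib_left[symmetric] sum.distrib sum_divide_distrib[symmetric] cardU)
  also have "\<dots> \<le> card P * (c * (L ^ m * (r / (m + 1))) + L ^ m * d)"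
  proof -
    have "real (m + 1) * real (\<Sum>u\<in>U. J u) \<le> r * (real L * real L ^ m)"
      using sum_card_below_le[of m L r] unfolding U_def[symmetric] J_def[symmetric] L_def[symmetric]
      by (metis of_nat_le_iff of_nat_mult of_nat_power power_Suc Suc_eq_plus1)
    then have "real (\<Sum>u\<in>U. J u) / L \<le> L ^ m * (r / (m + 1))"
      using L by (simp add: field_simps del: of_nat_sum)
    then show ?thesis using c by (intro mult_left_mono add_right_mono) auto
  qed
  finally show ?thesis by (simp add: L_def algebra_simps)
qed

section \<open>The balanced permutations as a double coset\<close>

lemma sum_comp_permutes:
  assumes "p permutes I"
  shows "(\<Sum>i\<in>I. f (p i)) = (\<Sum>i\<in>I. f i)"
  using sum.permute[OF assms, of f] by (simp add: comp_def)

text \<open>For transitivity, the pairs \<open>(A i, A (s i))\<close> form the same multiset for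
  every balanced \<open>s\<close>. Some \<open>h'\<close> therefore matches the pairs of
  \<open>s'\<close> with those of \<open>s\<close>: equal first components put \<open>h'\<close>
  into the stabiliser, and equal second components do so for the remaining left factor
  \<open>h\<close>.\<close>

lemma balanced_perms_double_coset:
  assumes A: "\<forall>i\<in>{1..n}. A i \<in> {0, 1}"
  shows "self_inverse_double_coset {1..n} {h. h permutes {1..n} \<and> (\<forall>i\<in>{1..n}. A (h i) = A i)}
    (balanced_perms n A)"
proof
  let ?I = "{1..n}"
  let ?G = "{h. h permutes ?I \<and> (\<forall>i\<in>?I. A (h i) = A i)}"
  fix h h' assume h: "h \<in> ?G" and h': "h' \<in> ?G"
  have p: "h permutes ?I" "h' permutes ?I" using h h' by auto
  have "A (h (h' i)) = A i" if "i \<in> ?I" for i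
    using h h' that permutes_in_image[OF p(2), of i] by simp
  then show "h \<circ> h' \<in> ?G"
    using permutes_compose[OF p(2,1)] by simp
  have "A (inv h i) = A i" if "i \<in> ?I" for i
  proof -
    have "inv h i \<in> ?I" using permutes_in_image[OF permutes_inv[OF p(1)], of i] that by blast
    then have "A (h (inv h i)) = A (inv h i)" using h by blast
    then show ?thesis by (simp add: permutes_inverses(1)[OF p(1)])
  qed
  then show "inv h \<in> ?G" using permutes_inv[OF p(1)] by simp
  fix s assume s: "s \<in> balanced_perms n A"
  then have ps: "s permutes ?I" by (simp add: balanced_perms_def)
  have "(\<Sum>i\<in>?I. of_bool (A i = a \<and> A ((h \<circ> s \<circ> h') i) = b)) = real n / 4"
    if ab: "a \<in> {0,1}" "b \<in> {0,1}" for a b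
  proof -
    have "(\<Sum>i\<in>?I. of_bool (A i = a \<and> A ((h \<circ> s \<circ> h') i) = b))
        = (\<Sum>i\<in>?I. of_bool (A (h' i) = a \<and> A (s (h' i)) = b) :: real)"
      using h h' permutes_in_image[OF p(2)] permutes_in_image[OF ps]
      by (intro sum.cong refl) auto
    also have "\<dots> = (\<Sum>i\<in>?I. of_bool (A i = a \<and> A (s i) = b))"
      by (rule sum_comp_permutes[OF p(2), of "\<lambda>i. of_bool (A i = a \<and> A (s i) = b)"])
    also have "\<dots> = real n / 4" using s ab unfolding balanced_perms_def by blast
    finally show ?thesis .
  qed
  then show "h \<circ> s \<circ> h' \<in> balanced_perms n A"
    unfolding balanced_perms_def
    using permutes_compose[OF p(2) permutes_compose[OF ps p(1)]] by (simp add: comp_assoc)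
next
  let ?I = "{1..n}"
  fix s assume s: "s \<in> balanced_perms n A"
  then have ps: "s permutes ?I" by (simp add: balanced_perms_def)
  then show "s permutes ?I" .
  have "(\<Sum>i\<in>?I. of_bool (A i = a \<and> A (inv s i) = b)) = real n / 4"
    if ab: "a \<in> {0,1}" "b \<in> {0,1}" for a b
  proof -
    have "(\<Sum>i\<in>?I. of_bool (A i = a \<and> A (inv s i) = b))
        = (\<Sum>i\<in>?I. of_bool (A (s i) = a \<and> A (inv s (s i)) = b) :: real)"
      by (rule sum_comp_permutes[OF ps, symmetric])
    also have "\<dots> = (\<Sum>i\<in>?I. of_bool (A i = b \<and> A (s i) = a))"
      by (intro sum.cong refl) (simp add: permutes_inverses[OF ps] conj_commute)
    also have "\<dots> = real n / 4" using s ab unfolding balanced_perms_def by blast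
    finally show ?thesis .
  qed
  then show "inv s \<in> balanced_perms n A"
    unfolding balanced_perms_def using permutes_inv[OF ps] by simp
  let ?G = "{h. h permutes ?I \<and> (\<forall>i\<in>?I. A (h i) = A i)}"
  fix s' assume s': "s' \<in> balanced_perms n A"
  then have ps': "s' permutes ?I" by (simp add: balanced_perms_def)
  \<comment> \<open>Each of the four pairs over \<open>{0,1}\<close> occurs exactly
    \<open>n div 4\<close> times, and the values of \<open>A\<close> exclude all other
    pairs.\<close>
  have cnt: "count (image_mset (\<lambda>i. (A i, A (r i))) (mset_set ?I)) (a, b)
      = (if a \<in> {0,1} \<and> b \<in> {0,1} then n div 4 else 0)" if r: "r \<in> balanced_perms n A" for r a b
  proof -
    have pr: "r permutes ?I" using r by (simp add: balanced_perms_def)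
    have "count (image_mset (\<lambda>i. (A i, A (r i))) (mset_set ?I)) (a, b)
        = card {i\<in>?I. A i = a \<and> A (r i) = b}"
      by (auto simp: count_image_mset' intro!: arg_cong[of _ _ card])
    also have "\<dots> = (if a \<in> {0,1} \<and> b \<in> {0,1} then n div 4 else 0)"
    proof (cases "a \<in> {0,1} \<and> b \<in> {0,1}")
      case True
      then have "real (card {i\<in>?I. A i = a \<and> A (r i) = b}) = real n / 4"
        using r unfolding balanced_perms_def by (auto simp: Int_def)
      then have "4 * card {i\<in>?I. A i = a \<and> A (r i) = b} = n" by linarith
      then show ?thesis using True by simp
    next
      case False
      have empty: "{i\<in>?I. A i = a \<and> A (r i) = b} = {}"
      proof (rule equals0I)
        fix i assume i: "i \<in> {i\<in>?I. A i = a \<and> A (r i) = b}"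
        then have "A i \<in> {0, 1}" "A (r i) \<in> {0, 1}"
          using A permutes_in_image[OF pr, of i] by blast+
        then show False using i False by auto
      qed
      show ?thesis unfolding empty if_not_P[OF False] by simp
    qed
    finally show ?thesis .
  qed
  have "image_mset (\<lambda>i. (A i, A (s' i))) (mset_set ?I) = image_mset (\<lambda>i. (A i, A (s i))) (mset_set ?I)"
  proof (rule multiset_eqI)
    fix ab :: "nat \<times> nat"
    show "count (image_mset (\<lambda>i. (A i, A (s' i))) (mset_set ?I)) ab
        = count (image_mset (\<lambda>i. (A i, A (s i))) (mset_set ?I)) ab"
      by (cases ab) (simp only: cnt[OF s] cnt[OF s'])
  qed
  then obtain h' where h': "h' permutes ?I" "\<forall>i\<in>?I. (A i, A (s' i)) = (A (h' i), A (s (h' i)))"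
    by (rule image_mset_eq_implies_permutes[OF finite_atLeastAtMost])
  \<comment> \<open>The equation \<open>s' = h \<circ> s \<circ> h'\<close> forces this choice of
    \<open>h\<close>.\<close>
  define q where "q = inv (s \<circ> h')"
  define h where "h = s' \<circ> q"
  have psh: "s \<circ> h' permutes ?I" by (intro permutes_compose ps h'(1))
  have pq: "q permutes ?I" unfolding q_def by (intro permutes_inv psh)
  have "A (h i) = A i" if i: "i \<in> ?I" for i
  proof -
    have "q i \<in> ?I" using permutes_in_image[OF pq] i by blast
    then have "A (s' (q i)) = A (s (h' (q i)))" using h'(2) by blast
    also have "s (h' (q i)) = i"
      unfolding q_def using permutes_inverses(1)[OF psh, of i] by simp
    finally show ?thesis by (simp add: h_def)
  qed
  then have "h \<in> ?G" using permutes_compose[OF pq ps'] unfolding h_def by simp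
  moreover have "h' \<in> ?G" using h' by auto
  moreover have "s' = h \<circ> s \<circ> h'"
    unfolding h_def q_def using permutes_inv_o(2)[OF psh] by (simp add: comp_assoc)
  ultimately show "\<exists>h\<in>?G. \<exists>h'\<in>?G. s' = h \<circ> s \<circ> h'" by blast
qed (auto intro: permutes_id)

section \<open>Exchangeable data and uniform samples\<close>

text \<open>Permuting data acts from the right. Comparing data already permuted by \<open>q\<close>
  with its further permutations is therefore comparing \<open>q\<close> with its neighbours in the
  Cayley graph.\<close>

lemma permuted_permuted:
  assumes "p permutes {1..n}"
  shows "permuted n (permuted n y q) p = permuted n y (q \<circ> p)"
proof
  fix i
  show "permuted n (permuted n y q) p i = permuted n y (q \<circ> p) i"
    using permutes_in_image[OF assms, of i] by (simp add: permuted_def restrict_def)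
qed

lemma measurable_permuted:
  assumes p: "p permutes {1..n}"
  shows "(\<lambda>y. permuted n y p) \<in> data_space n N \<rightarrow>\<^sub>M data_space n N"
  unfolding permuted_def
proof (rule measurable_restrict)
  fix i assume "i \<in> {1..n}"
  then have "p i \<in> {1..n}" using permutes_in_image[OF p, of i] by blast
  then show "(\<lambda>y. y (p i)) \<in> data_space n N \<rightarrow>\<^sub>M N"
    by (rule measurable_component_singleton)
qed

context prob_space
begin

text \<open>All permuted data have the same law, so each probability equals its average over
  \<open>p\<close>, and \<open>bound\<close> is integrated pointwise. This replaces a random
  permutation by a finite sum. The index \<open>u\<close> stands for the sampled tuple.\<close>

lemma sum_prob_exchangeable_le:
  assumes exch: "exchangeable n N Y" and U: "finite U"
    and E: "\<And>u. u \<in> U \<Longrightarrow> E u \<in> sets (data_space n N)"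
    and bound: "\<And>y. y \<in> space (data_space n N) \<Longrightarrow>
      (\<Sum>p | p permutes {1..n}. card {u\<in>U. permuted n y p \<in> E u})
        \<le> real (card {p. p permutes {1..n}}) * c"
  shows "(\<Sum>u\<in>U. prob {\<omega>\<in>space M. permuted n (\<lambda>i. Y i \<omega>) id \<in> E u}) \<le> c"
proof -
  let ?D = "data_space n N" and ?P = "{p. p permutes {1..n}}"
  define Z where "Z p \<omega> = permuted n (\<lambda>i. Y i \<omega>) p" for p \<omega>
  have finP: "finite ?P" by (simp add: finite_permutations)
  have cP: "card ?P > 0" using finP by (auto simp: card_gt_0_iff intro: permutes_id)
  have Y: "random_variable N (Y i)" if "i \<in> {1..n}" for i
    using exch that unfolding exchangeable_def by blast
  have Z: "Z p \<in> M \<rightarrow>\<^sub>M ?D" if "p permutes {1..n}" for p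
    unfolding Z_def permuted_def
  proof (rule measurable_restrict)
    show "random_variable N (Y (p i))" if "i \<in> {1..n}" for i
      by (rule Y) (use that permutes_in_image[OF \<open>p permutes {1..n}\<close>] in blast)
  qed
  have prob_Z: "prob {\<omega>\<in>space M. Z p \<omega> \<in> E u} = prob {\<omega>\<in>space M. Z id \<omega> \<in> E u}"
    if p: "p permutes {1..n}" and u: "u \<in> U" for p u
  proof -
    have *: "prob {\<omega>\<in>space M. Z q \<omega> \<in> E u} = measure (distr M ?D (Z q)) (E u)"
      if "q permutes {1..n}" for q
      using measure_distr[OF Z[OF that] E[OF u]] by (simp add: vimage_def Int_def conj_commute)
    have "distr M ?D (Z p) = distr M ?D (Z id)"
      using exch p unfolding exchangeable_def Z_def by blast
    then show ?thesis using *[OF p] *[OF permutes_id] by simp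
  qed
  have ev: "{\<omega>\<in>space M. Z p \<omega> \<in> E u} \<in> events" if "p \<in> ?P" "u \<in> U" for p u
    using measurable_sets[OF Z E[OF that(2)], of p] that(1)
    by (simp add: vimage_def Int_def conj_commute)
  have int: "integrable M (indicator {\<omega>\<in>space M. Z p \<omega> \<in> E u} :: _ \<Rightarrow> real)"
    if "p \<in> ?P" "u \<in> U" for p u
    using ev[OF that] by (simp add: integrable_indicator_iff emeasure_eq_measure)
  have "card ?P * (\<Sum>u\<in>U. prob {\<omega>\<in>space M. Z id \<omega> \<in> E u})
      = (\<Sum>p\<in>?P. \<Sum>u\<in>U. prob {\<omega>\<in>space M. Z id \<omega> \<in> E u})"
    by simp
  also have "\<dots> = (\<Sum>p\<in>?P. \<Sum>u\<in>U. prob {\<omega>\<in>space M. Z p \<omega> \<in> E u})"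
    by (intro sum.cong refl prob_Z[symmetric]) auto
  also have "\<dots> = (\<Sum>p\<in>?P. \<Sum>u\<in>U. \<integral>\<omega>. indicator {\<omega>\<in>space M. Z p \<omega> \<in> E u} \<omega> \<partial>M)"
    using ev by (intro sum.cong refl) (simp add: Int_absorb2 sets.sets_into_space)
  also have "\<dots> = (\<integral>\<omega>. (\<Sum>p\<in>?P. \<Sum>u\<in>U. indicator {\<omega>\<in>space M. Z p \<omega> \<in> E u} \<omega>) \<partial>M)"
  proof -
    have "(\<Sum>u\<in>U. \<integral>\<omega>. indicator {\<omega>\<in>space M. Z p \<omega> \<in> E u} \<omega> \<partial>M)
        = (\<integral>\<omega>. (\<Sum>u\<in>U. indicator {\<omega>\<in>space M. Z p \<omega> \<in> E u} \<omega> :: real) \<partial>M)" if "p \<in> ?P" for p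
      by (rule Bochner_Integration.integral_sum[symmetric]) (rule int[OF that])
    then have "(\<Sum>p\<in>?P. \<Sum>u\<in>U. \<integral>\<omega>. indicator {\<omega>\<in>space M. Z p \<omega> \<in> E u} \<omega> \<partial>M)
        = (\<Sum>p\<in>?P. \<integral>\<omega>. (\<Sum>u\<in>U. indicator {\<omega>\<in>space M. Z p \<omega> \<in> E u} \<omega> :: real) \<partial>M)"
      by (rule sum.cong[OF refl])
    also have "\<dots> = (\<integral>\<omega>. (\<Sum>p\<in>?P. \<Sum>u\<in>U. indicator {\<omega>\<in>space M. Z p \<omega> \<in> E u} \<omega> :: real) \<partial>M)"
      by (intro Bochner_Integration.integral_sum[symmetric] Bochner_Integration.integrable_sum int)
    finally show ?thesis .
  qed
  also have "\<dots> \<le> (\<integral>\<omega>. card ?P * c \<partial>M)"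
  proof (rule integral_mono)
    fix \<omega> assume \<omega>: "\<omega> \<in> space M"
    have y: "Z id \<omega> \<in> space ?D" using measurable_space[OF Z[OF permutes_id] \<omega>] .
    have "(\<Sum>p\<in>?P. \<Sum>u\<in>U. indicator {\<omega>\<in>space M. Z p \<omega> \<in> E u} \<omega> :: real)
        = (\<Sum>p\<in>?P. real (card {u\<in>U. permuted n (Z id \<omega>) p \<in> E u}))"
    proof (rule sum.cong[OF refl])
      fix p assume "p \<in> ?P"
      then have "p permutes {1..n}" by simp
      from permuted_permuted[OF this, of "\<lambda>i. Y i \<omega>" id]
      have "permuted n (Z id \<omega>) p = Z p \<omega>"
        by (simp only: Z_def id_comp)
      then have "{u\<in>U. permuted n (Z id \<omega>) p \<in> E u} = U \<inter> {u. Z p \<omega> \<in> E u}"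
        by auto
      moreover have "(\<Sum>u\<in>U. indicator {\<omega>\<in>space M. Z p \<omega> \<in> E u} \<omega> :: real)
          = (\<Sum>u\<in>U. of_bool (Z p \<omega> \<in> E u))"
        by (rule sum.cong[OF refl]) (simp add: \<omega>)
      ultimately show "(\<Sum>u\<in>U. indicator {\<omega>\<in>space M. Z p \<omega> \<in> E u} \<omega> :: real)
          = real (card {u\<in>U. permuted n (Z id \<omega>) p \<in> E u})"
        by (simp only:) (intro sum_of_bool_eq U)
    qed
    also have "\<dots> \<le> card ?P * c" using bound[OF y] by simp
    finally show "(\<Sum>p\<in>?P. \<Sum>u\<in>U. indicator {\<omega>\<in>space M. Z p \<omega> \<in> E u} \<omega> :: real) \<le> card ?P * c" .
  next
    show "integrable M (\<lambda>\<omega>. \<Sum>p\<in>?P. \<Sum>u\<in>U. indicator {\<omega>\<in>space M. Z p \<omega> \<in> E u} \<omega> :: real)"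
      by (intro Bochner_Integration.integrable_sum int)
  qed simp
  also have "\<dots> = card ?P * c" by (simp add: prob_space)
  finally show ?thesis using cP unfolding Z_def by simp
qed

lemma prob_iid_uniform:
  assumes iid: "iid_uniform m S X" and m: "m \<ge> 1" and S: "finite S" and u: "u \<in> {1..m} \<rightarrow>\<^sub>E S"
  shows "prob {\<omega>\<in>space M. (\<lambda>j\<in>{1..m}. X j \<omega>) = u} = 1 / card S ^ m"
proof -
  have rv: "random_variable (count_space S) (X j)" if "j \<in> {1..m}" for j
    using iid that unfolding iid_uniform_def indep_vars_def by blast
  define F where "F j = X j -` {u j} \<inter> space M" for j
  \<comment> \<open>For \<open>m \<ge> 1\<close> this is an intersection over a nonempty index set,
    to which the product rule for independent events applies.\<close>
  have "{\<omega>\<in>space M. (\<lambda>j\<in>{1..m}. X j \<omega>) = u} = (\<Inter>j\<in>{1..m}. F j)"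
  proof (rule set_eqI)
    fix \<omega>
    have "(\<lambda>j\<in>{1..m}. X j \<omega>) = u \<longleftrightarrow> (\<forall>j\<in>{1..m}. X j \<omega> = u j)"
      using u by (auto simp: PiE_iff fun_eq_iff restrict_def extensional_def)
    then show "\<omega> \<in> {\<omega>\<in>space M. (\<lambda>j\<in>{1..m}. X j \<omega>) = u} \<longleftrightarrow> \<omega> \<in> (\<Inter>j\<in>{1..m}. F j)"
      using m unfolding F_def by auto
  qed
  also have "prob \<dots> = (\<Prod>j\<in>{1..m}. prob (F j))"
  proof (rule indep_setsD)
    show "indep_sets (\<lambda>j. {X j -` B \<inter> space M | B. B \<in> sets (count_space S)}) {1..m}"
      using iid unfolding iid_uniform_def indep_vars_def2 by blast
    show "\<forall>j\<in>{1..m}. F j \<in> {X j -` B \<inter> space M | B. B \<in> sets (count_space S)}"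
      using u unfolding F_def by (auto simp: PiE_iff)
  qed (use m in auto)
  also have "\<dots> = (\<Prod>j\<in>{1..m}. 1 / card S)"
  proof (rule prod.cong[OF refl])
    fix j assume j: "j \<in> {1..m}"
    then have uj: "u j \<in> S" using u by auto
    have "prob (F j) = measure (distr M (count_space S) (X j)) {u j}"
      unfolding F_def using measure_distr[OF rv[OF j], of "{u j}"] uj by simp
    also have "\<dots> = measure (uniform_count_measure S) {u j}"
      using iid j unfolding iid_uniform_def by simp
    also have "\<dots> = 1 / card S"
      using measure_uniform_count_measure[OF S, of "{u j}"] uj by simp
    finally show "prob (F j) = 1 / card S" .
  qed
  also have "\<dots> = 1 / card S ^ m" by (simp add: power_divide)
  finally show ?thesis .
qed

end

section \<open>The bounds for sampled and for exhaustive p-values\<close>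

theorem proposition10:
  fixes n :: nat and A :: "nat \<Rightarrow> nat"
    and M :: "'w measure" and N :: "'y measure"
    and Y :: "nat \<Rightarrow> 'w \<Rightarrow> 'y" and T :: "(nat \<Rightarrow> 'y) \<Rightarrow> real"
  assumes "0 < n" and "4 dvd n"
    and "\<forall>i\<in>{1..n}. A i \<in> {0, 1}"
    and "real (\<Sum>i=1..n. A i) = real n / 2"
    and "prob_space M"
    and "standard_borel_space N"
    and "prob_space.exchangeable M n N Y"
    and "T \<in> borel_measurable (data_space n N)"
  shows "(\<forall>m\<ge>1. \<forall>\<sigma> :: nat \<Rightarrow> 'w \<Rightarrow> nat \<Rightarrow> nat.
            prob_space.iid_uniform M m (balanced_perms n A) \<sigma> \<and>
            prob_space.indep_rv M
              (Pi\<^sub>M {1..m} (\<lambda>_. count_space (balanced_perms n A))) (\<lambda>\<omega>. \<lambda>j\<in>{1..m}. \<sigma> j \<omega>)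
              (data_space n N) (\<lambda>\<omega>. \<lambda>i\<in>{1..n}. Y i \<omega>) \<longrightarrow>
            (\<forall>\<alpha>\<in>{0..1}.
               measure M {\<omega> \<in> space M. p_value n T m (\<lambda>j. \<sigma> j \<omega>) (\<lambda>i. Y i \<omega>) \<le> \<alpha>}
                 \<le> 2 * \<alpha> * (1 - 1 / real (Bal n A)) + 2 / real (Bal n A))) \<and>
         (\<forall>\<alpha>\<in>{0..1}.
            measure M {\<omega> \<in> space M. p_value_inf n A T (\<lambda>i. Y i \<omega>) \<le> \<alpha>}
              \<le> 2 * \<alpha> * (1 - 1 / real (Bal n A)) + 2 / real (Bal n A))"
proof -
  interpret prob_space M by fact
  let ?I = "{1..n}" and ?D = "data_space n N" and ?S = "balanced_perms n A"
  let ?G = "{h. h permutes ?I \<and> (\<forall>i\<in>?I. A (h i) = A i)}" and ?P = "{p. p permutes ?I}"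
  interpret dc: self_inverse_double_coset ?I ?G ?S
    by (rule balanced_perms_double_coset) fact
  define k where "k = Bal n A"
  \<comment> \<open>The argument yields \<open>1 / k\<close> as the last summand, which is stronger
    than the claimed \<open>2 / k\<close>.\<close>
  define bnd where "bnd \<alpha> = 2 * \<alpha> * (1 - 1 / real k) + 1 / real k" for \<alpha> :: real
  \<comment> \<open>These are the neighbours of \<open>p\<close> that do at least as well as
    \<open>p\<close>; their proportion in \<open>?S\<close> is the exhaustive p-value of the data
    permuted by \<open>p\<close>.\<close>
  define q where "q y p = {s\<in>?S. T (permuted n y (p \<circ> s)) \<ge> T (permuted n y p)}" for y p
  have "k \<in> bal_sizes n A"
    unfolding k_def Bal_def using finite_bal_sizes[OF \<open>0 < n\<close>] one_in_bal_sizes by (intro Max_in) auto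
  then obtain \<tau> :: "nat \<Rightarrow> nat \<Rightarrow> nat" where \<tau>: "\<And>i. i \<in> {1..k} \<Longrightarrow> \<tau> i permutes ?I"
    "\<And>i j. i \<in> {1..k} \<Longrightarrow> j \<in> {1..k} \<Longrightarrow> i \<noteq> j \<Longrightarrow> \<tau> i \<circ> inv (\<tau> j) \<in> ?S"
    unfolding bal_sizes_def by blast
  have k1: "k \<ge> 1"
    unfolding k_def Bal_def using finite_bal_sizes[OF \<open>0 < n\<close>] one_in_bal_sizes by (rule Max_ge)
  have few: "card {p\<in>?P. card (q y p) \<le> x} \<le> card ?P * (2 * (1 - 1 / k) * (x / card ?S) + 1 / k)"
    if "k \<ge> 2" "0 \<le> x" for x :: real and y :: "nat \<Rightarrow> 'y"
  proof (rule dc.few_edges_imp_small)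
    \<comment> \<open>\<open>Bal\<close> asks for balanced
      \<open>\<tau> i \<circ> inv (\<tau> j)\<close>, whereas edges of the Cayley graph are of the
      form \<open>inv (\<kappa> i) \<circ> \<kappa> j\<close>. Inverting the witnesses turns one
      into the other.\<close>
    show "inv (\<tau> i) permutes ?I" if "i \<in> {1..k}" for i
      using \<tau>(1)[OF that] by (rule permutes_inv)
    show "inv (inv (\<tau> i)) \<circ> inv (\<tau> j) \<in> ?S" if "i \<in> {1..k}" "j \<in> {1..k}" "i \<noteq> j" for i j
      using \<tau>(2)[OF that] permutes_inv_inv[OF \<tau>(1)[OF that(1)]] by simp
    show "(\<Sum>p\<in>?P. \<Sum>s\<in>?S. of_bool (p \<in> {p\<in>?P. card (q y p) \<le> x})
          * of_bool (p \<circ> s \<in> {p\<in>?P. card (q y p) \<le> x}))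
        \<le> 2 * x * card {p\<in>?P. card (q y p) \<le> x}"
      using dc.sum_edges_le[of "\<lambda>p. T (permuted n y p)" x] unfolding q_def by simp
  qed (use that in auto)
  have cP: "card ?P > 0"
    using dc.finite_P by (auto simp: card_gt_0_iff intro: permutes_id)
  have cS: "card ?S > 0" if "k \<ge> 2"
    using \<tau>(2)[of 1 2] that dc.finite_S by (auto simp: card_gt_0_iff)
  have space_permuted: "permuted n y p \<in> space ?D" if "y \<in> space ?D" "p permutes ?I" for y p
    using measurable_space[OF measurable_permuted[OF that(2)] that(1)] .
  have T_meas: "(\<lambda>y. T (permuted n y p)) \<in> borel_measurable ?D" if "p permutes ?I" for p
    using measurable_compose[OF measurable_permuted[OF that] \<open>T \<in> borel_measurable ?D\<close>] .
  have ge_meas: "(\<lambda>y. of_bool (T (permuted n y p) \<ge> T (permuted n y id)) :: real) \<in> borel_measurable ?D"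
    if "p permutes ?I" for p
    unfolding of_bool_def
    by (intro measurable_If borel_measurable_const borel_measurable_le T_meas that permutes_id)
  \<comment> \<open>For \<open>k = 1\<close> the claimed bound is 2.\<close>
  have trivial: "prob Q \<le> 2 * \<alpha> * (1 - 1 / real k) + 2 / real k" if "k < 2" for Q and \<alpha> :: real
  proof -
    have "k = 1" using that k1 by simp
    moreover have "prob Q \<le> 2" using prob_le_1[of Q] by linarith
    ultimately show ?thesis by simp
  qed
  have bnd_le: "bnd \<alpha> \<le> 2 * \<alpha> * (1 - 1 / real k) + 2 / real k" for \<alpha>
    unfolding bnd_def by (simp add: divide_right_mono)
  have bnd_mono: "bnd \<alpha> \<le> bnd \<alpha>'" if "\<alpha> \<le> \<alpha>'" for \<alpha> \<alpha>'
    unfolding bnd_def using that k1 by (intro add_right_mono mult_right_mono) auto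
  have inf: "prob {\<omega>\<in>space M. p_value_inf n A T (\<lambda>i. Y i \<omega>) \<le> \<alpha>} \<le> bnd \<alpha>"
    if \<alpha>: "\<alpha> \<in> {0..1}" and k: "k \<ge> 2" for \<alpha>
  proof -
    define E where "E = {y\<in>space ?D. p_value_inf n A T y \<le> \<alpha>}"
    have p_eq: "p_value_inf n A T (permuted n y p) = card (q y p) / card ?S" if "p permutes ?I" for y p
      unfolding p_value_inf_def q_def using that dc.finite_S dc.S_permutes
      by (simp add: permuted_permuted permutes_id Int_def conj_commute cong: conj_cong sum.cong)
    have "E \<in> sets ?D"
      unfolding E_def p_value_inf_def
      by (intro borel_measurable_le borel_measurable_divide borel_measurable_sum
          borel_measurable_const ge_meas dc.S_permutes)
    \<comment> \<open>Without sampling there is only one event, hence the one-element index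
      set.\<close>
    then have "(\<Sum>u\<in>{()}. prob {\<omega>\<in>space M. permuted n (\<lambda>i. Y i \<omega>) id \<in> E}) \<le> bnd \<alpha>"
    proof (intro sum_prob_exchangeable_le[OF \<open>exchangeable n N Y\<close>])
      fix y assume y: "y \<in> space ?D"
      have "(\<Sum>p\<in>?P. card {u\<in>{()}. permuted n y p \<in> E}) = (\<Sum>p\<in>?P. of_bool (permuted n y p \<in> E))"
        by (intro sum.cong refl) auto
      also have "\<dots> = card {p\<in>?P. permuted n y p \<in> E}"
        using dc.finite_P by (simp add: Int_def)
      also have "{p\<in>?P. permuted n y p \<in> E} = {p\<in>?P. card (q y p) \<le> \<alpha> * card ?S}"
        unfolding E_def using cS[OF k] space_permuted[OF y] by (auto simp: p_eq field_simps)
      also have "real (card \<dots>) \<le> card ?P * bnd \<alpha>"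
        unfolding bnd_def using few[OF k, of "\<alpha> * card ?S" y] \<alpha> cS[OF k] by (simp add: ac_simps)
      finally show "(\<Sum>p\<in>?P. card {u\<in>{()}. permuted n y p \<in> E}) \<le> real (card ?P) * bnd \<alpha>" .
    qed auto
    moreover have "permuted n (\<lambda>i. Y i \<omega>) id \<in> E \<longleftrightarrow> p_value_inf n A T (\<lambda>i. Y i \<omega>) \<le> \<alpha>"
      if \<omega>: "\<omega> \<in> space M" for \<omega>
    proof -
      have "permuted n (\<lambda>i. Y i \<omega>) id \<in> space ?D"
        using \<omega> \<open>exchangeable n N Y\<close>
        by (auto simp: permuted_def exchangeable_def space_PiM intro: measurable_space)
      then show ?thesis
        unfolding E_def p_value_inf_def using dc.S_permutes
        by (simp add: permuted_permuted permutes_id cong: sum.cong)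
    qed
    ultimately show ?thesis by (simp cong: conj_cong)
  qed
  have fin: "prob {\<omega>\<in>space M. p_value n T m (\<lambda>j. \<sigma> j \<omega>) (\<lambda>i. Y i \<omega>) \<le> \<alpha>} \<le> bnd \<alpha>"
    if m: "m \<ge> 1" and iid: "iid_uniform m ?S \<sigma>"
      and indep: "indep_rv (Pi\<^sub>M {1..m} (\<lambda>_. count_space ?S)) (\<lambda>\<omega>. \<lambda>j\<in>{1..m}. \<sigma> j \<omega>)
        ?D (\<lambda>\<omega>. \<lambda>i\<in>?I. Y i \<omega>)"
      and \<alpha>: "\<alpha> \<in> {0..1}" and k: "k \<ge> 2" for m \<alpha> and \<sigma> :: "nat \<Rightarrow> 'w \<Rightarrow> nat \<Rightarrow> nat"
  proof -
    \<comment> \<open>Given \<open>c\<close> exceedances, the p-value is at most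
      \<open>\<alpha>\<close> iff \<open>1 + c\<close> is at most this floor. The 1 in the numerator
      makes the condition the strict \<open>c < r\<close>.\<close>
    define r where "r = nat \<lfloor>\<alpha> * (real m + 1)\<rfloor>"
    define U where "U = {1..m} \<rightarrow>\<^sub>E ?S"
    define E where "E u = {y\<in>space ?D.
      card {j\<in>{1..m}. T (permuted n y (u j)) \<ge> T (permuted n y id)} < r}" for u :: "nat \<Rightarrow> nat \<Rightarrow> nat"
    define V where "V = (\<lambda>\<omega>. \<lambda>j\<in>{1..m}. \<sigma> j \<omega>)"
    define Z where "Z = (\<lambda>\<omega>. permuted n (\<lambda>i. Y i \<omega>) id)"
    have finU: "finite U" unfolding U_def by (intro finite_PiE dc.finite_S) auto
    have "real r \<le> \<alpha> * (real m + 1)"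
      unfolding r_def using \<alpha> by simp
    then have r_le: "r / (m + 1) \<le> \<alpha>" by (simp add: field_simps)
    have rank: "(1 + real c) / (real m + 1) \<le> \<alpha> \<longleftrightarrow> c < r" for c
      unfolding r_def using \<alpha> by (simp add: field_simps) linarith
    have U_permutes: "u j permutes ?I" if "u \<in> U" "j \<in> {1..m}" for u j
      by (rule dc.S_permutes) (use that in \<open>auto simp: U_def PiE_iff\<close>)
    have E: "E u \<in> sets ?D" if "u \<in> U" for u
    proof -
      have "E u = {y\<in>space ?D.
          (\<Sum>j=1..m. of_bool (T (permuted n y (u j)) \<ge> T (permuted n y id)) :: real) < r}"
        unfolding E_def by (simp add: Int_def)
      also have "\<dots> \<in> sets ?D"
        by (intro borel_measurable_less borel_measurable_sum borel_measurable_const ge_meas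
            U_permutes[OF that])
      finally show ?thesis .
    qed
    have rvV: "random_variable (Pi\<^sub>M {1..m} (\<lambda>_. count_space ?S)) V"
      and rvZ: "random_variable ?D Z"
      and ind: "indep_set {V -` B \<inter> space M | B. B \<in> sets (Pi\<^sub>M {1..m} (\<lambda>_. count_space ?S))}
        {Z -` B \<inter> space M | B. B \<in> sets ?D}"
      using indep unfolding indep_rv_def V_def Z_def permuted_def by auto
    have V_in: "V \<omega> \<in> U" if "\<omega> \<in> space M" for \<omega>
      using measurable_space[OF rvV that] by (simp add: U_def space_PiM)
    have V_ev: "{\<omega>\<in>space M. V \<omega> = u} \<in> {V -` B \<inter> space M | B. B \<in> sets (Pi\<^sub>M {1..m} (\<lambda>_. count_space ?S))}"
      if "u \<in> U" for u
    proof -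
      have "{u} = (\<Pi>\<^sub>E j\<in>{1..m}. {u j})"
        using that unfolding U_def by (intro PiE_singleton[symmetric]) (auto simp: PiE_iff)
      also have "\<dots> \<in> sets (Pi\<^sub>M {1..m} (\<lambda>_. count_space ?S))"
        using that unfolding U_def by (intro sets_PiM_I_finite) auto
      finally show ?thesis by (auto intro!: exI[of _ "{u}"])
    qed
    have Z_ev: "{\<omega>\<in>space M. Z \<omega> \<in> E u} \<in> {Z -` B \<inter> space M | B. B \<in> sets ?D}" if "u \<in> U" for u
      using E[OF that] by blast
    have events: "{\<omega>\<in>space M. V \<omega> = u} \<inter> {\<omega>\<in>space M. Z \<omega> \<in> E u} \<in> events" if "u \<in> U" for u
      using V_ev[OF that] Z_ev[OF that] measurable_sets[OF rvV] measurable_sets[OF rvZ] by auto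
    \<comment> \<open>The event is split by the value of the sampled tuple. Independence then
      factors each part, and every tuple has the same probability.\<close>
    have "{\<omega>\<in>space M. p_value n T m (\<lambda>j. \<sigma> j \<omega>) (\<lambda>i. Y i \<omega>) \<le> \<alpha>}
        \<subseteq> (\<Union>u\<in>U. {\<omega>\<in>space M. V \<omega> = u} \<inter> {\<omega>\<in>space M. Z \<omega> \<in> E u})"
    proof clarify
      fix \<omega> assume \<omega>: "\<omega> \<in> space M" and le: "p_value n T m (\<lambda>j. \<sigma> j \<omega>) (\<lambda>i. Y i \<omega>) \<le> \<alpha>"
      have "card {j\<in>{1..m}. T (permuted n (\<lambda>i. Y i \<omega>) (\<sigma> j \<omega>)) \<ge> T (permuted n (\<lambda>i. Y i \<omega>) id)} < r"
        using le rank unfolding p_value_def by (simp add: Int_def)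
      also have "{j\<in>{1..m}. T (permuted n (\<lambda>i. Y i \<omega>) (\<sigma> j \<omega>)) \<ge> T (permuted n (\<lambda>i. Y i \<omega>) id)}
          = {j\<in>{1..m}. T (permuted n (Z \<omega>) (V \<omega> j)) \<ge> T (permuted n (Z \<omega>) id)}"
      proof (intro Collect_cong conj_cong refl)
        fix j assume j: "j \<in> {1..m}"
        have "\<sigma> j \<omega> permutes ?I"
          using U_permutes[OF V_in[OF \<omega>] j] j by (simp add: V_def)
        then show "T (permuted n (\<lambda>i. Y i \<omega>) (\<sigma> j \<omega>)) \<ge> T (permuted n (\<lambda>i. Y i \<omega>) id)
            \<longleftrightarrow> T (permuted n (Z \<omega>) (V \<omega> j)) \<ge> T (permuted n (Z \<omega>) id)"
          using j by (simp add: Z_def V_def permuted_permuted permutes_id)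
      qed
      finally have "Z \<omega> \<in> E (V \<omega>)"
        unfolding E_def using measurable_space[OF rvZ \<omega>] by simp
      then show "\<omega> \<in> (\<Union>u\<in>U. {\<omega>\<in>space M. V \<omega> = u} \<inter> {\<omega>\<in>space M. Z \<omega> \<in> E u})"
        using \<omega> V_in[OF \<omega>] by blast
    qed
    then have "prob {\<omega>\<in>space M. p_value n T m (\<lambda>j. \<sigma> j \<omega>) (\<lambda>i. Y i \<omega>) \<le> \<alpha>}
        \<le> prob (\<Union>u\<in>U. {\<omega>\<in>space M. V \<omega> = u} \<inter> {\<omega>\<in>space M. Z \<omega> \<in> E u})"
      using finU events by (intro finite_measure_mono sets.finite_UN) auto
    also have "\<dots> \<le> (\<Sum>u\<in>U. prob ({\<omega>\<in>space M. V \<omega> = u} \<inter> {\<omega>\<in>space M. Z \<omega> \<in> E u}))"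
      using finU events by (intro finite_measure_subadditive_finite) auto
    also have "\<dots> = (\<Sum>u\<in>U. prob {\<omega>\<in>space M. V \<omega> = u} * prob {\<omega>\<in>space M. Z \<omega> \<in> E u})"
      by (intro sum.cong refl indep_setD[OF ind] V_ev Z_ev)
    also have "\<dots> = (\<Sum>u\<in>U. prob {\<omega>\<in>space M. Z \<omega> \<in> E u}) / card ?S ^ m"
      using prob_iid_uniform[OF iid m dc.finite_S] unfolding V_def U_def
      by (simp add: sum_divide_distrib)
    \<comment> \<open>For data permuted by \<open>p\<close>, the sampled permutations that count as
      exceedances are those in \<open>q y p\<close>. So \<open>sum_few_hits_le\<close> applies with
      \<open>D = q y\<close>, and \<open>few\<close> supplies its affine bound at every
      level.\<close>
    also have "\<dots> \<le> (card ?S ^ m * (2 * (1 - 1 / k) * (r / (m + 1)) + 1 / k)) / card ?S ^ m"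
    proof (rule divide_right_mono)
      show "(\<Sum>u\<in>U. prob {\<omega>\<in>space M. Z \<omega> \<in> E u})
          \<le> card ?S ^ m * (2 * (1 - 1 / k) * (r / (m + 1)) + 1 / k)"
        unfolding Z_def
      proof (rule sum_prob_exchangeable_le[OF \<open>exchangeable n N Y\<close> finU E])
        fix y assume y: "y \<in> space ?D"
        have eq: "(\<Sum>p\<in>?P. card {u\<in>U. permuted n y p \<in> E u})
            = (\<Sum>p\<in>?P. card {u \<in> {1..m} \<rightarrow>\<^sub>E ?S. card {j\<in>{1..m}. u j \<in> q y p} < r})"
        proof (intro sum.cong refl arg_cong[of _ _ card] Collect_cong)
          fix p u assume p: "p \<in> ?P"
          have "permuted n y p \<in> E u \<longleftrightarrow> card {j\<in>{1..m}. u j \<in> q y p} < r" if u: "u \<in> U"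
          proof -
            have "{j\<in>{1..m}. T (permuted n (permuted n y p) (u j)) \<ge> T (permuted n (permuted n y p) id)}
                = {j\<in>{1..m}. u j \<in> q y p}"
              using U_permutes[OF u] u unfolding q_def U_def
              by (auto simp: permuted_permuted permutes_id PiE_iff)
            then show ?thesis
              unfolding E_def using space_permuted[OF y] p by simp
          qed
          then show "(u \<in> U \<and> permuted n y p \<in> E u)
              \<longleftrightarrow> (u \<in> {1..m} \<rightarrow>\<^sub>E ?S \<and> card {j\<in>{1..m}. u j \<in> q y p} < r)"
            unfolding U_def by blast
        qed
        show "(\<Sum>p\<in>?P. card {u\<in>U. permuted n y p \<in> E u})
            \<le> real (card ?P) * (card ?S ^ m * (2 * (1 - 1 / k) * (r / (m + 1)) + 1 / k))"
        proof -
          have D: "\<And>p. p \<in> ?P \<Longrightarrow> q y p \<subseteq> ?S" and c: "0 \<le> 2 * (1 - 1 / real k)"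
            using k by (auto simp: q_def divide_simps)
          have "card {p\<in>?P. card (q y p) \<le> x} \<le> card ?P * (2 * (1 - 1 / k) * (x / card ?S) + 1 / k)"
            for x :: nat
            using few[OF k, of "real x" y] by simp
          note bound = this
          have "real (\<Sum>p\<in>?P. card {u \<in> {1..m} \<rightarrow>\<^sub>E ?S. card {j\<in>{1..m}. u j \<in> q y p} < r})
              \<le> real (card ?P) * (real (card ?S ^ m)
                * (2 * (1 - 1 / real k) * (real r / (real m + 1)) + 1 / real k))"
            by (rule sum_few_hits_le[OF dc.finite_P dc.finite_S cS[OF k] _ c bound]) (rule D)
          then show ?thesis
            by (simp only: eq of_nat_add of_nat_1)
        qed
      qed
    qed simp
    also have "\<dots> = bnd (r / (m + 1))"
      using cS[OF k] by (simp add: bnd_def ac_simps)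
    also have "\<dots> \<le> bnd \<alpha>" by (rule bnd_mono[OF r_le])
    finally show ?thesis .
  qed
  show ?thesis
    unfolding k_def[symmetric]
  proof (intro conjI allI impI ballI)
    fix m :: nat and \<sigma> :: "nat \<Rightarrow> 'w \<Rightarrow> nat \<Rightarrow> nat" and \<alpha> :: real
    assume m: "m \<ge> 1" and \<alpha>: "\<alpha> \<in> {0..1}"
      and \<sigma>: "iid_uniform m ?S \<sigma> \<and> indep_rv (Pi\<^sub>M {1..m} (\<lambda>_. count_space ?S))
        (\<lambda>\<omega>. \<lambda>j\<in>{1..m}. \<sigma> j \<omega>) ?D (\<lambda>\<omega>. \<lambda>i\<in>?I. Y i \<omega>)"
    show "prob {\<omega>\<in>space M. p_value n T m (\<lambda>j. \<sigma> j \<omega>) (\<lambda>i. Y i \<omega>) \<le> \<alpha>}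
        \<le> 2 * \<alpha> * (1 - 1 / real k) + 2 / real k"
    proof (cases "k < 2")
      case False
      then have "k \<ge> 2" by simp
      from order_trans[OF fin[OF m conjunct1[OF \<sigma>] conjunct2[OF \<sigma>] \<alpha> this] bnd_le] show ?thesis .
    qed (rule trivial)
  next
    fix \<alpha> :: real assume \<alpha>: "\<alpha> \<in> {0..1}"
    show "prob {\<omega>\<in>space M. p_value_inf n A T (\<lambda>i. Y i \<omega>) \<le> \<alpha>}
        \<le> 2 * \<alpha> * (1 - 1 / real k) + 2 / real k"
    proof (cases "k < 2")
      case False
      then have "k \<ge> 2" by simp
      from order_trans[OF inf[OF \<alpha> this] bnd_le] show ?thesis .
    qed (rule trivial)
  qed
qed

end
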